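(* Let $P_n$ be the path on $n$ vertices and $L=\{1,\dots,l\}$ the label set. If $|L|\ge 5n$, then Alice wins every ESD labeling game on $P_n$ with label set $L$.
   Context: For a graph $G=(V,E)$ and $l\in\mathbb N$, a vertex labeling $\phi:V\to\{1,\dots,l\}$ is an edge-sum distinguishing (ESD) labeling if $\phi$ is injective and the edge-weights $w_\phi(uv)=\phi(u)+\phi(v)$ are pairwise distinct over all edges $uv\in E$. ESD labeling game on $G$ with label set $L=\{1,\dots,l\}$: Alice and Bob alternate moves, Alice starting. In each move the player chooses a not-yet-labeled vertex and assigns to it a label from $L$ not used before; the move is legal if the edge-weights of edges with both endpoints labeled remain pairwise distinct. The game ends when no legal move is possible or an ESD labeling of $G$ is created; Alice wins if an ESD labeling is created, otherwise Bob wins. *)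

theory Defs
  imports Main
begin

text \<open>A graph is a pair of a vertex set and a set of edges, each edge being a two-element
  set of vertices; hence the weight of the edge \<open>{u, v}\<close> below is \<open>\<phi> u + \<phi> v\<close>.\<close>

type_synonym 'v graph = "'v set \<times> 'v set set"

abbreviation verts :: "'v graph \<Rightarrow> 'v set" where
  "verts G \<equiv> fst G"

abbreviation edges :: "'v graph \<Rightarrow> 'v set set" where
  "edges G \<equiv> snd G"

definition path_graph :: "nat \<Rightarrow> nat graph" where
  "path_graph n = ({..<n}, {{i, Suc i} | i. Suc i < n})"

definition edge_weight :: "('v \<Rightarrow> nat) \<Rightarrow> 'v set \<Rightarrow> nat" where
  "edge_weight \<phi> e = (\<Sum>v\<in>e. \<phi> v)"

definition esd_labeling :: "'v graph \<Rightarrow> nat set \<Rightarrow> ('v \<Rightarrow> nat) \<Rightarrow> bool" where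
  "esd_labeling G L \<phi> \<longleftrightarrow>
     \<phi> ` verts G \<subseteq> L \<and> inj_on \<phi> (verts G) \<and> inj_on (edge_weight \<phi>) (edges G)"


type_synonym 'v position = "'v \<rightharpoonup> nat"
type_synonym 'v move = "'v \<times> nat"

definition weights_distinct :: "'v graph \<Rightarrow> 'v position \<Rightarrow> bool" where
  "weights_distinct G p \<longleftrightarrow>
     inj_on (edge_weight (\<lambda>v. the (p v))) {e \<in> edges G. e \<subseteq> dom p}"

definition legal_move :: "'v graph \<Rightarrow> nat set \<Rightarrow> 'v position \<Rightarrow> 'v move \<Rightarrow> bool" where
  "legal_move G L p = (\<lambda>(v, a).
     v \<in> verts G \<and> v \<notin> dom p \<and> a \<in> L \<and> a \<notin> ran p \<and> weights_distinct G (p(v \<mapsto> a)))"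

text \<open>A play is the chronological list of the moves made so far. As no vertex is
  labeled twice, the position reached by a play \<open>ms\<close> is \<open>map_of ms\<close>.\<close>

inductive play :: "'v graph \<Rightarrow> nat set \<Rightarrow> 'v move list \<Rightarrow> bool" for G L where
  start: "play G L []"
| move: "play G L ms \<Longrightarrow> legal_move G L (map_of ms) m \<Longrightarrow> play G L (ms @ [m])"

definition esd_created :: "'v graph \<Rightarrow> nat set \<Rightarrow> 'v position \<Rightarrow> bool" where
  "esd_created G L p \<longleftrightarrow> dom p = verts G \<and> esd_labeling G L (\<lambda>v. the (p v))"

text \<open>Once an ESD labeling is created there is no unlabeled vertex left, so \<^const>\<open>play\<close>
  never continues past the end of the game.\<close>

definition game_over :: "'v graph \<Rightarrow> nat set \<Rightarrow> 'v position \<Rightarrow> bool" where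
  "game_over G L p \<longleftrightarrow> (\<nexists>m. legal_move G L p m) \<or> esd_created G L p"

definition finished_play :: "'v graph \<Rightarrow> nat set \<Rightarrow> 'v move list \<Rightarrow> bool" where
  "finished_play G L ms \<longleftrightarrow> play G L ms \<and> game_over G L (map_of ms)"

definition alice_wins_play :: "'v graph \<Rightarrow> nat set \<Rightarrow> 'v move list \<Rightarrow> bool" where
  "alice_wins_play G L ms \<longleftrightarrow> finished_play G L ms \<and> esd_created G L (map_of ms)"

text \<open>Alice starts, so she is to move exactly after an even number of moves.\<close>

definition alice_follows :: "('v move list \<Rightarrow> 'v move) \<Rightarrow> 'v move list \<Rightarrow> bool" where
  "alice_follows \<sigma> ms \<longleftrightarrow> (\<forall>i<length ms. even i \<longrightarrow> ms ! i = \<sigma> (take i ms))"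

text \<open>A winning strategy must also prescribe a legal move whenever Alice has to move;
  every play is finite, since each move labels a new vertex.\<close>

definition alice_winning_strategy ::
    "'v graph \<Rightarrow> nat set \<Rightarrow> ('v move list \<Rightarrow> 'v move) \<Rightarrow> bool" where
  "alice_winning_strategy G L \<sigma> \<longleftrightarrow>
     (\<forall>ms. play G L ms \<and> alice_follows \<sigma> ms \<and> even (length ms) \<and> \<not> game_over G L (map_of ms)
        \<longrightarrow> legal_move G L (map_of ms) (\<sigma> ms)) \<and>
     (\<forall>ms. finished_play G L ms \<and> alice_follows \<sigma> ms \<longrightarrow> alice_wins_play G L ms)"

end

theory Submission
  imports Defs
begin

text \<open>An injective partial labeling with distinct edge weights can be extended at any unlabeled
  vertex \<open>v\<close>: the label \<open>a\<close> of \<open>v\<close> must avoid the used labels and, for every labeled neighbor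
  \<open>u\<close> of \<open>v\<close>, the values \<open>w - \<phi> u\<close>, where \<open>w\<close> ranges over the weights already present; two new
  edges at \<open>v\<close> cannot collide as their other ends have distinct labels. On a path this excludes
  at most \<open>n + 2 * n < 5 * n\<close> labels, so no play gets stuck before all vertices are labeled.\<close>

definition neighbors :: "'v graph \<Rightarrow> 'v \<Rightarrow> 'v set" where
  "neighbors G v = {u. {u, v} \<in> edges G}"

text \<open>The invariant of every play. Edges with an unlabeled end are unconstrained, as
  \<open>weights_distinct\<close> looks only at edges inside \<open>dom p\<close>.\<close>

definition partial_esd :: "'v graph \<Rightarrow> nat set \<Rightarrow> 'v position \<Rightarrow> bool" where
  "partial_esd G L p \<longleftrightarrow>
     dom p \<subseteq> verts G \<and> ran p \<subseteq> L \<and> inj_on p (dom p) \<and> weights_distinct G p"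

lemma edge_weight_fun_upd_outside:
  assumes "v \<notin> e"
  shows "edge_weight (\<lambda>x. the ((p(v \<mapsto> a)) x)) e = edge_weight (\<lambda>x. the (p x)) e"
  unfolding edge_weight_def using assms by (intro sum.cong) auto

lemma edge_weight_fun_upd_pair:
  assumes "u \<noteq> v"
  shows "edge_weight (\<lambda>x. the ((p(v \<mapsto> a)) x)) {u, v} = the (p u) + a"
  unfolding edge_weight_def using assms by simp

lemma edge_at_vertexE:
  assumes "e \<in> edges G" "card e = 2" "v \<in> e"
  obtains u where "u \<in> neighbors G v" "u \<noteq> v" "e = {u, v}"
proof -
  obtain x y where "e = {x, y}" "x \<noteq> y"
    using assms(2) by (auto simp: card_2_iff)
  with assms that show thesis
    by (auto simp: neighbors_def insert_commute)
qed

text \<open>The condition \<open>fresh\<close> ranges over all neighbors and edges, labeled or not.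
  This only asks more of \<open>a\<close>, and the later count then needs no record of what is
  labeled so far.\<close>

lemma weights_distinct_fun_upd:
  assumes two: "\<And>e. e \<in> edges G \<Longrightarrow> card e = 2"
    and inj: "inj_on p (dom p)"
    and wd: "weights_distinct G p"
    and fresh: "\<And>u e. \<lbrakk>u \<in> neighbors G v; e \<in> edges G\<rbrakk>
                  \<Longrightarrow> a \<noteq> edge_weight (\<lambda>x. the (p x)) e - the (p u)"
  shows "weights_distinct G (p(v \<mapsto> a))"
proof -
  let ?w = "edge_weight (\<lambda>x. the ((p(v \<mapsto> a)) x))"
  \<comment> \<open>Here the choice of \<open>a\<close> enters: equal weights would mean
    \<open>the (p u) + a = w\<close> for the weight \<open>w\<close> of \<open>f\<close>, so the
    truncated difference \<open>w - the (p u)\<close> would be exactly \<open>a\<close>.\<close>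
  have mixed: "?w e \<noteq> ?w f"
    if e: "e \<in> edges G" "v \<in> e" and f: "f \<in> edges G" "v \<notin> f" for e f
  proof -
    obtain u where u: "u \<in> neighbors G v" "u \<noteq> v" "e = {u, v}"
      using edge_at_vertexE e two by metis
    have "?w e = the (p u) + a"
      using edge_weight_fun_upd_pair u by metis
    moreover have "?w f = edge_weight (\<lambda>x. the (p x)) f"
      using edge_weight_fun_upd_outside f by metis
    ultimately show ?thesis
      using fresh[OF u(1) f(1)] by auto
  qed
  show ?thesis
    unfolding weights_distinct_def
  proof (rule inj_onI; elim CollectE conjE)
    fix e f
    assume e: "e \<in> edges G" "e \<subseteq> dom (p(v \<mapsto> a))"
      and f: "f \<in> edges G" "f \<subseteq> dom (p(v \<mapsto> a))"
      and eq: "?w e = ?w f"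
    consider "v \<in> e" "v \<in> f" | "v \<notin> e" "v \<notin> f"
      using mixed e f eq by metis
    then show "e = f"
    proof cases
      case 1
      obtain x where x: "x \<noteq> v" "e = {x, v}"
        using edge_at_vertexE e two 1 by metis
      obtain y where y: "y \<noteq> v" "f = {y, v}"
        using edge_at_vertexE f two 1 by metis
      have "x \<in> dom p" "y \<in> dom p"
        using e f x y by auto
      moreover have "the (p x) = the (p y)"
        using eq edge_weight_fun_upd_pair x y by (metis add_right_cancel)
      \<comment> \<open>Both ends are labeled, so equal values under \<open>the\<close> lift to
        equal options, to which injectivity of \<open>p\<close> applies.\<close>
      ultimately have "x = y"
        using inj by (metis domIff inj_onD option.expand)
      then show ?thesis
        using x y by simp
    next
      case 2
      then have "edge_weight (\<lambda>x. the (p x)) e = edge_weight (\<lambda>x. the (p x)) f"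
        using eq edge_weight_fun_upd_outside by metis
      moreover have "e \<subseteq> dom p" "f \<subseteq> dom p"
        using e f 2 by auto
      ultimately show ?thesis
        using wd e f unfolding weights_distinct_def by (auto dest: inj_onD)
    qed
  qed
qed

lemma legal_move_exists:
  assumes fin: "finite (verts G)" "finite (edges G)"
    and edges: "\<And>e. e \<in> edges G \<Longrightarrow> e \<subseteq> verts G \<and> card e = 2"
    and p: "partial_esd G L p"
    and v: "v \<in> verts G" "v \<notin> dom p"
    and large: "card (verts G) + card (neighbors G v) * card (edges G) < card L"
  shows "\<exists>a. legal_move G L p (v, a)"
proof -
  \<comment> \<open>The values forbidden by weights, at most one per pair of a neighbor and an edge.
    Unlabeled vertices contribute unspecified values, which only enlarge the set and are covered by
    the count.\<close>
  let ?F = "(\<lambda>(u, e). edge_weight (\<lambda>x. the (p x)) e - the (p u)) ` (neighbors G v \<times> edges G)"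
  have dom: "finite (dom p)" "card (dom p) \<le> card (verts G)"
    using p fin by (auto simp: partial_esd_def intro: finite_subset card_mono)
  have ran: "ran p = (\<lambda>x. the (p x)) ` dom p"
    by (force simp: ran_def dom_def)
  have "neighbors G v \<subseteq> verts G"
    using edges by (auto simp: neighbors_def)
  then have finN: "finite (neighbors G v)"
    using fin(1) finite_subset by blast
  have "card (ran p \<union> ?F) \<le> card (ran p) + card ?F"
    by (rule card_Un_le)
  also have "\<dots> \<le> card (verts G) + card (neighbors G v \<times> edges G)"
    unfolding ran using dom finN fin
    by (intro add_mono card_image_le order.trans[OF card_image_le]) auto
  also have "\<dots> < card L"
    using large by (simp add: card_cartesian_product)
  finally have "\<not> L \<subseteq> ran p \<union> ?F"
    using dom(1) finN fin(2) ran card_mono[of "ran p \<union> ?F" L] by auto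
  then obtain a where a: "a \<in> L" "a \<notin> ran p" "a \<notin> ?F"
    by blast
  have "weights_distinct G (p(v \<mapsto> a))"
    using p edges a(3) by (intro weights_distinct_fun_upd) (auto simp: partial_esd_def)
  then show ?thesis
    using a v by (auto simp: legal_move_def)
qed

lemma partial_esd_play:
  assumes "play G L ms"
    and "\<And>e. e \<in> edges G \<Longrightarrow> e \<noteq> {}"
  shows "partial_esd G L (map_of ms)"
  using assms(1)
proof induction
  case start
  show ?case
    using assms(2) by (auto simp: partial_esd_def weights_distinct_def inj_on_def)
next
  case (move ms m)
  obtain v a where m: "m = (v, a)"
    by fastforce
  have legal: "v \<in> verts G" "v \<notin> dom (map_of ms)" "a \<in> L" "a \<notin> ran (map_of ms)"
    "weights_distinct G ((map_of ms)(v \<mapsto> a))"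
    using move.hyps(2) by (auto simp: m legal_move_def)
  \<comment> \<open>In \<open>map_of\<close> earlier entries take precedence; the pair appended at
    the end acts as an update because \<open>v\<close> is still unlabeled.\<close>
  have "map_of (ms @ [m]) = (map_of ms)(v \<mapsto> a)"
    using legal(2) by (auto simp: m map_add_def fun_eq_iff split: option.split)
  moreover have "inj_on ((map_of ms)(v \<mapsto> a)) (dom ((map_of ms)(v \<mapsto> a)))"
    using move.IH legal(2,4) unfolding partial_esd_def inj_on_def
    by (auto simp: ran_def)
  moreover have "dom ((map_of ms)(v \<mapsto> a)) \<subseteq> verts G"
    using move.IH legal(1) by (simp add: partial_esd_def)
  moreover have "ran ((map_of ms)(v \<mapsto> a)) \<subseteq> L"
    using move.IH legal(2,3) by (simp add: partial_esd_def domIff)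
  ultimately show ?case
    unfolding partial_esd_def using legal(5) by (simp only: simp_thms)
qed

text \<open>With every vertex labeled, the restriction to edges inside \<open>dom p\<close> becomes
  vacuous, so the invariant turns into the full ESD condition.\<close>

lemma esd_created_if_partial_esd:
  assumes "partial_esd G L p" "dom p = verts G"
    and "\<And>e. e \<in> edges G \<Longrightarrow> e \<subseteq> verts G"
  shows "esd_created G L p"
proof -
  have "{e \<in> edges G. e \<subseteq> dom p} = edges G"
    using assms(2,3) by auto
  moreover have "inj_on (\<lambda>v. the (p v)) (verts G)"
  proof (rule inj_onI)
    fix x y
    assume "x \<in> verts G" "y \<in> verts G" "the (p x) = the (p y)"
    then have "x \<in> dom p" "y \<in> dom p" "p x = p y"
      using assms(2) by (auto simp: domIff intro: option.expand)
    then show "x = y"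
      using assms(1) by (auto simp: partial_esd_def dest: inj_onD)
  qed
  moreover have "(\<lambda>v. the (p v)) ` verts G \<subseteq> L"
  proof (rule image_subsetI)
    fix v
    assume "v \<in> verts G"
    then obtain a where "p v = Some a"
      using assms(2) by blast
    then show "the (p v) \<in> L"
      using assms(1) ranI[of p v a] by (auto simp: partial_esd_def)
  qed
  ultimately show ?thesis
    using assms(1,2) by (simp add: esd_created_def esd_labeling_def partial_esd_def weights_distinct_def)
qed

lemma alice_wins_finished_play:
  assumes "finite (verts G)" "finite (edges G)"
    and edges: "\<And>e. e \<in> edges G \<Longrightarrow> e \<subseteq> verts G \<and> card e = 2"
    and "\<And>v. v \<in> verts G \<Longrightarrow> card (verts G) + card (neighbors G v) * card (edges G) < card L"
    and fin: "finished_play G L ms"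
  shows "alice_wins_play G L ms"
proof -
  have p: "partial_esd G L (map_of ms)"
    using fin edges by (intro partial_esd_play) (fastforce simp: finished_play_def)+
  have "esd_created G L (map_of ms)"
  proof (cases "dom (map_of ms) = verts G")
    case True
    with p edges show ?thesis
      by (intro esd_created_if_partial_esd) auto
  next
    case False
    then obtain v where "v \<in> verts G" "v \<notin> dom (map_of ms)"
      using p by (auto simp: partial_esd_def)
    \<comment> \<open>An unlabeled vertex leaves a legal move, so \<open>game_over\<close> can hold
      only through its other disjunct.\<close>
    then have "\<exists>m. legal_move G L (map_of ms) m"
      using legal_move_exists[of G L "map_of ms" v] assms p by blast
    then show ?thesis
      using fin by (auto simp: finished_play_def game_over_def)
  qed
  with fin show ?thesis
    by (simp add: alice_wins_play_def)
qed

text \<open>If no play can be lost, playing any legal move is a winning strategy; one exists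
  whenever the game is not over.\<close>

lemma alice_winning_strategy_if_wins_always:
  assumes "\<And>ms. finished_play G L ms \<Longrightarrow> alice_wins_play G L ms"
  shows "alice_winning_strategy G L (\<lambda>ms. SOME m. legal_move G L (map_of ms) m)"
  using assms by (auto simp: alice_winning_strategy_def game_over_def intro: someI)

lemma path_graph_edges:
  "edges (path_graph n) = (\<lambda>i. {i, Suc i}) ` {i. Suc i < n}"
  by (auto simp: path_graph_def)

lemma finite_edges_path_graph: "finite (edges (path_graph n))"
  and card_edges_path_graph: "card (edges (path_graph n)) \<le> n"
proof -
  have sub: "{i. Suc i < n} \<subseteq> {..<n}"
    by auto
  then have fin: "finite {i. Suc i < n}"
    using finite_subset by blast
  then show "finite (edges (path_graph n))"
    by (simp add: path_graph_edges)
  have "card (edges (path_graph n)) \<le> card {i. Suc i < n}"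
    unfolding path_graph_edges using fin by (rule card_image_le)
  also have "\<dots> \<le> card {..<n}"
    using sub by (intro card_mono) simp_all
  finally show "card (edges (path_graph n)) \<le> n"
    by simp
qed

lemma card_neighbors_path_graph: "card (neighbors (path_graph n) v) \<le> 2"
proof -
  \<comment> \<open>For \<open>v = 0\<close> the truncated \<open>v - 1\<close> is \<open>0\<close>
    itself, a harmless extra element.\<close>
  have "neighbors (path_graph n) v \<subseteq> {v - 1, Suc v}"
    by (auto simp: neighbors_def path_graph_def doubleton_eq_iff)
  then have "card (neighbors (path_graph n) v) \<le> card {v - 1, Suc v}"
    by (intro card_mono) auto
  also have "\<dots> \<le> 2"
    by (simp add: card_insert_if)
  finally show ?thesis .
qed

theorem theorem14:
  fixes n l :: nat and L :: "nat set"
  assumes "L = {1..l}"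
    and "card L \<ge> 5 * n"
  shows "(\<forall>ms. finished_play (path_graph n) L ms \<longrightarrow> alice_wins_play (path_graph n) L ms) \<and>
         (\<exists>\<sigma>. alice_winning_strategy (path_graph n) L \<sigma>)"
proof -
  let ?G = "path_graph n"
  have V: "verts ?G = {..<n}"
    by (simp add: path_graph_def)
  have "card (verts ?G) + card (neighbors ?G v) * card (edges ?G) < card L"
    if "v \<in> verts ?G" for v
    \<comment> \<open>The left side is at most \<open>n + 2 * n\<close>; the existence of
      \<open>v\<close> gives \<open>0 < n\<close>, hence strictness below
      \<open>5 * n\<close>.\<close>
    using mult_le_mono[OF card_neighbors_path_graph[of n v] card_edges_path_graph[of n]] that assms(2)
    by (simp add: V)
  then have wins: "alice_wins_play ?G L ms" if "finished_play ?G L ms" for ms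
    using that finite_edges_path_graph
    by (intro alice_wins_finished_play) (auto simp: V path_graph_edges)
  then show ?thesis
    using alice_winning_strategy_if_wins_always[of ?G L] by blast
qed

end
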